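(* Let $X$ be a nonempty set and let $\mathcal{U}=\{A_1,\dots,A_n\}$ be a partition of $X$ into $n$ sets with $n\ge4$. Then $$S_{\mathcal{U}}(C_\infty(\mathcal{U}))=\begin{cases}\lfloor \log_2 n\rfloor & \text{if } n\le 1+3\cdot 2^{\lfloor \log_2 n\rfloor-1},\\ \lceil \log_2 n\rceil & \text{if } n> 1+3\cdot 2^{\lfloor \log_2 n\rfloor-1}.\end{cases}$$
   Context: A partition of $X$ is a family of nonempty pairwise disjoint subsets whose union is $X$. For a family $\mathcal{U}$ of subsets of $X$, let $C_1(\mathcal{U})$ be the family of all sets of the form $E_1\cap E_2$, $E_1\cup E_2$ or $X\setminus E_1$ with $E_1,E_2\in\mathcal{U}$ (possibly $E_1=E_2$). Set $C_0(\mathcal{U})=\mathcal{U}$, $C_n(\mathcal{U})=C_1(C_{n-1}(\mathcal{U}))$ for $n\ge1$, and $C_\infty(\mathcal{U})=\bigcup_{n\ge1}C_n(\mathcal{U})$. For families $\mathcal{U},\mathcal{H}$, $S_{\mathcal{U}}(\mathcal{H})=\inf\{n\ge0:\mathcal{H}\subseteq C_n(\mathcal{U})\}$ (with $\inf\emptyset=\infty$). *)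

theory Defs
  imports Complex_Main "HOL-Library.Extended_Nat" "HOL-Library.Disjoint_Sets"
begin

definition C1 :: "'a set \<Rightarrow> 'a set set \<Rightarrow> 'a set set" where
  "C1 X U = {E1 \<inter> E2 | E1 E2. E1 \<in> U \<and> E2 \<in> U}
          \<union> {E1 \<union> E2 | E1 E2. E1 \<in> U \<and> E2 \<in> U}
          \<union> {X - E1 | E1. E1 \<in> U}"

primrec C :: "'a set \<Rightarrow> nat \<Rightarrow> 'a set set \<Rightarrow> 'a set set" where
  "C X 0 U = U"
| "C X (Suc n) U = C1 X (C X n U)"

definition C_infty :: "'a set \<Rightarrow> 'a set set \<Rightarrow> 'a set set" where
  "C_infty X U = (\<Union>n\<in>{1..}. C X n U)"

(* The infimum is taken in enat, where Inf {} = \<infinity>. *)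
definition S :: "'a set \<Rightarrow> 'a set set \<Rightarrow> 'a set set \<Rightarrow> enat" where
  "S X U H = Inf (enat ` {n. H \<subseteq> C X n U})"

end

theory Submission
  imports Defs
begin

text \<open>
  Taking unions turns the iteration on \<open>U\<close> into the iteration on the power set of the index set
  \<open>U\<close>, started at the singletons. There the \<open>m\<close>-th stage with \<open>m \<ge> 2\<close> consists exactly of the
  subfamilies of cardinality at most \<open>2 ^ m\<close> (unions double the size) or at least
  \<open>n - 2 ^ (m - 1)\<close> (complements come one stage later). Hence stage \<open>m\<close> is everything precisely
  when \<open>n \<le> 1 + 3 * 2 ^ (m - 1)\<close>.
\<close>

section \<open>Basic properties of the closure step\<close>

lemma C1_I:
  shows "A \<in> F \<Longrightarrow> B \<in> F \<Longrightarrow> A \<inter> B \<in> C1 X F"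
    and "A \<in> F \<Longrightarrow> B \<in> F \<Longrightarrow> A \<union> B \<in> C1 X F"
    and "A \<in> F \<Longrightarrow> X - A \<in> C1 X F"
  unfolding C1_def by blast+

lemma C1_cases:
  assumes "E \<in> C1 X F"
  obtains A B where "A \<in> F" "B \<in> F" "E = A \<inter> B"
    | A B where "A \<in> F" "B \<in> F" "E = A \<union> B"
    | A where "A \<in> F" "E = X - A"
  using assms unfolding C1_def by blast

lemma C1_increasing: "F \<subseteq> C1 X F"
  using C1_I(1)[of _ F] by fastforce

lemma C_mono: "i \<le> j \<Longrightarrow> C X i F \<subseteq> C X j F"
  by (rule lift_Suc_mono_le[of "\<lambda>i. C X i F"]) (simp_all add: C1_increasing)

lemma C_subset_Pow: "F \<subseteq> Pow X \<Longrightarrow> C X m F \<subseteq> Pow X"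
  by (induction m) (auto simp: C1_def)

text \<open>Meant for \<open>h = Union\<close>. The hypotheses are restricted to members of
  \<open>F\<close> because \<open>Union\<close> respects intersections and complements only on
  subfamilies of a partition.\<close>

lemma C1_image:
  assumes "\<And>A B. A \<in> F \<Longrightarrow> B \<in> F \<Longrightarrow> h (A \<inter> B) = h A \<inter> h B"
    and "\<And>A B. A \<in> F \<Longrightarrow> B \<in> F \<Longrightarrow> h (A \<union> B) = h A \<union> h B"
    and "\<And>A. A \<in> F \<Longrightarrow> h (Y - A) = X - h A"
  shows "C1 X (h ` F) = h ` C1 Y F"
proof
  show "C1 X (h ` F) \<subseteq> h ` C1 Y F"
    by (auto elim!: C1_cases simp: assms[symmetric] intro!: imageI C1_I)
  show "h ` C1 Y F \<subseteq> C1 X (h ` F)"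
    by (auto elim!: C1_cases simp: assms intro!: C1_I)
qed

section \<open>Passage from a partition to its index set\<close>

lemma partition_on_Union_Int:
  assumes "partition_on X U" "J \<subseteq> U" "K \<subseteq> U"
  shows "\<Union>(J \<inter> K) = \<Union>J \<inter> \<Union>K"
  using assms disjointD[OF partition_onD2[OF assms(1)]] by blast

lemma partition_on_Union_Diff:
  assumes "partition_on X U" "J \<subseteq> U"
  shows "\<Union>(U - J) = X - \<Union>J"
  using assms disjointD[OF partition_onD2[OF assms(1)]] partition_onD1[OF assms(1)] by blast

text \<open>Every block is nonempty, and any of its points lies in no other block, so a union
  determines its blocks. This carries a subfamily missing from a stage over to a missing
  union.\<close>

lemma partition_on_Union_inj:
  assumes "partition_on X U"
  shows "inj_on Union (Pow U)"
proof (rule inj_onI)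
  have sub: "J \<subseteq> K" if JK: "J \<in> Pow U" "K \<in> Pow U" and eq: "\<Union>J = \<Union>K" for J K
  proof
    fix A assume A: "A \<in> J"
    with JK partition_onD3[OF assms] have "A \<in> U" "A \<noteq> {}" by auto
    then obtain x where x: "x \<in> A" by blast
    with A eq obtain B where "B \<in> K" "x \<in> B" by blast
    then show "A \<in> K"
      using x \<open>A \<in> U\<close> JK disjointD[OF partition_onD2[OF assms], of A B] by blast
  qed
  fix J K assume "J \<in> Pow U" "K \<in> Pow U" "\<Union>J = \<Union>K"
  then show "J = K" using sub[of J K] sub[of K J] by auto
qed

abbreviation singletons :: "'a set \<Rightarrow> 'a set set" where
  "singletons V \<equiv> (\<lambda>a. {a}) ` V"

lemma C_partition_on:
  assumes "partition_on X U"
  shows "C X m U = Union ` C U m (singletons U)"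
proof (induction m)
  case 0
  show ?case by (simp add: image_image)
next
  case (Suc m)
  have "C U m (singletons U) \<subseteq> Pow U"
    by (rule C_subset_Pow) auto
  then have "C1 X (Union ` C U m (singletons U)) = Union ` C1 U (C U m (singletons U))"
    by (intro C1_image)
      (auto intro!: partition_on_Union_Int[OF assms] partition_on_Union_Diff[OF assms]
        simp del: Union_Int_subset)
  then show ?case using Suc by simp
qed

section \<open>Cardinalities reached at each stage\<close>

text \<open>Cutting \<open>J\<close> into two halves doubles the reachable size at each stage. The
  count starts at stage 1, since stage 0 lacks the empty set.\<close>

lemma small_in_C:
  assumes "2 \<le> card V" "J \<subseteq> V" "card J \<le> 2 ^ Suc m"
  shows "J \<in> C V (Suc m) (singletons V)"
  using assms(2,3)
proof (induction m arbitrary: J)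
  case 0
  have fin: "finite V" using assms(1) by (intro card_ge_0_finite) simp
  \<comment> \<open>The empty set will be the intersection of two distinct singletons.\<close>
  obtain a b where ab: "a \<in> V" "b \<in> V" "a \<noteq> b"
  proof -
    obtain T where "T \<subseteq> V" "card T = 2"
      using obtain_subset_with_card_n[OF assms(1)] by blast
    then show thesis using that by (auto simp: card_2_iff)
  qed
  consider "card J = 0" | "card J = 1" | "card J = 2" using 0 by force
  then show ?case
  proof cases
    case 1
    then have "J = {a} \<inter> {b}" using ab finite_subset[OF 0(1) fin] by simp
    then show ?thesis using ab C1_I(1)[of "{a}" "singletons V" "{b}"] by simp
  next
    case 2
    then obtain x where "J = {x}" by (auto simp: card_1_singleton_iff)
    then show ?thesis using 0(1) C1_increasing by fastforce
  next
    case 3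
    then obtain x y where "J = {x} \<union> {y}" by (auto simp: card_2_iff)
    then show ?thesis using 0(1) C1_I(2)[of "{x}" "singletons V" "{y}"] by simp
  qed
next
  case (Suc m)
  have "finite V" using assms(1) by (intro card_ge_0_finite) simp
  then have fin: "finite J" using Suc.prems(1) by (rule rev_finite_subset)
  obtain K where K: "K \<subseteq> J" "card K = card J div 2"
    using obtain_subset_with_card_n[of "card J div 2" J] by auto
  have "card (J - K) = card J - card J div 2"
    using K fin by (simp add: card_Diff_subset finite_subset)
  then have "card K \<le> 2 ^ Suc m" "card (J - K) \<le> 2 ^ Suc m"
    using K Suc.prems(2) by auto
  then have "K \<in> C V (Suc m) (singletons V)" "J - K \<in> C V (Suc m) (singletons V)"
    using Suc.IH[of K] Suc.IH[of "J - K"] K Suc.prems(1) by blast+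
  then have "K \<union> (J - K) \<in> C V (Suc (Suc m)) (singletons V)"
    by (simp only: C.simps C1_I)
  then show ?case using K by (simp add: Un_absorb1 Un_Diff_cancel)
qed

lemma large_in_C:
  assumes "2 \<le> card V" "J \<subseteq> V" "card V \<le> card J + 2 ^ Suc m"
  shows "J \<in> C V (Suc (Suc m)) (singletons V)"
proof -
  have "finite V" using assms(1) by (intro card_ge_0_finite) simp
  then have "card (V - J) \<le> 2 ^ Suc m"
    using assms by (simp add: card_Diff_subset finite_subset)
  then have "V - J \<in> C V (Suc m) (singletons V)"
    using small_in_C[OF assms(1)] by blast
  then have "V - (V - J) \<in> C V (Suc (Suc m)) (singletons V)"
    by (simp only: C.simps C1_I)
  then show ?thesis using assms(2) by (simp add: double_diff)
qed

text \<open>Sharper than the general dichotomy below: the equation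
  \<open>Suc (card J) = card V\<close> excludes \<open>J = V\<close>, which an inequality would
  allow.\<close>

lemma C_singletons_1:
  assumes "finite V" "J \<in> C V (Suc 0) (singletons V)"
  shows "card J \<le> 2 \<or> Suc (card J) = card V"
proof -
  have "J \<in> C1 V (singletons V)" using assms(2) by simp
  then show ?thesis
  proof (cases rule: C1_cases)
    case (1 A B)
    then obtain a where "J \<subseteq> {a}" by auto
    then have "card J \<le> card {a}" by (intro card_mono) auto
    then show ?thesis by simp
  next
    case (2 A B)
    then obtain a b where "J = {a, b}" by auto
    then show ?thesis by (simp add: card_insert_if)
  next
    case (3 A)
    then obtain a where "a \<in> V" "J = V - {a}" by auto
    then show ?thesis using card_Suc_Diff1[OF assms(1)] by simp
  qed
qed

text \<open>Call a set small or large according to the disjunct it satisfies. Unions at most double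
  small sizes, intersections at most double the number of elements that large sets lack, and
  complements exchange the two kinds.\<close>

lemma C_singletons_small_or_large:
  assumes "finite V" "J \<in> C V (Suc m) (singletons V)"
  shows "card J \<le> 2 ^ Suc m \<or> card V \<le> card J + 2 ^ m"
  using assms(2)
proof (induction m arbitrary: J)
  case 0
  then show ?case using C_singletons_1[OF assms(1), of J] by auto
next
  case (Suc m)
  have sub: "K \<subseteq> V" if "K \<in> C V (Suc m) (singletons V)" for K
    using that C_subset_Pow[of "singletons V" V "Suc m"] by auto
  have fin: "finite K" if "K \<in> C V (Suc m) (singletons V)" for K
    using sub[OF that] assms(1) finite_subset by blast
  have "J \<in> C1 V (C V (Suc m) (singletons V))" using Suc.prems by simp
  then show ?case
  proof (cases rule: C1_cases)
    case (1 A B)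
    have "card J \<le> card A" "card J \<le> card B"
      using 1 fin by (auto intro!: card_mono)
    \<comment> \<open>If both sets are large, inclusion-exclusion bounds what \<open>J\<close> lacks
      by the sum of what \<open>A\<close> and \<open>B\<close> lack.\<close>
    moreover have "card A + card B = card (A \<union> B) + card J"
      using card_Un_Int[OF fin[OF 1(1)] fin[OF 1(2)]] 1 by simp
    moreover have "card (A \<union> B) \<le> card V"
      using sub 1 assms(1) by (intro card_mono) auto
    ultimately show ?thesis
      using Suc.IH[OF 1(1)] Suc.IH[OF 1(2)] by simp linarith
  next
    case (2 A B)
    have "card A \<le> card J" "card B \<le> card J"
      using 2 fin by (auto intro!: card_mono)
    moreover have "card J \<le> card A + card B"
      using 2 card_Un_le by auto
    ultimately show ?thesis
      using Suc.IH[OF 2(1)] Suc.IH[OF 2(2)] by simp linarith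
  next
    case (3 A)
    have "card J = card V - card A" "card A \<le> card V"
      using 3 sub assms(1) fin by (auto simp: card_Diff_subset card_mono)
    then show ?thesis
      using Suc.IH[OF 3(1)] by simp linarith
  qed
qed

text \<open>The small and large ranges leave no gap: the first size that is not small is
  \<open>2 ^ (m + 2) + 1\<close>, and adding \<open>2 ^ (m + 1)\<close> gives exactly the bound on
  \<open>card V\<close>.\<close>

lemma C_singletons_eq_Pow:
  assumes "2 \<le> card V" "card V \<le> 1 + 3 * 2 ^ Suc m"
  shows "C V (Suc (Suc m)) (singletons V) = Pow V"
proof
  show "C V (Suc (Suc m)) (singletons V) \<subseteq> Pow V"
    by (rule C_subset_Pow) auto
  have "J \<in> C V (Suc (Suc m)) (singletons V)" if "J \<subseteq> V" for J
  proof (cases "card J \<le> 2 ^ Suc (Suc m)")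
    case True
    then show ?thesis using small_in_C[OF assms(1) that] by blast
  next
    case False
    then have "card V \<le> card J + 2 ^ Suc m" using assms(2) by simp
    then show ?thesis by (rule large_in_C[OF assms(1) that])
  qed
  then show "Pow V \<subseteq> C V (Suc (Suc m)) (singletons V)" by blast
qed

text \<open>
  The disjunct \<open>m = 0\<close> accounts for \<open>card V = 4\<close>: all sizes but the full one occur at stage 1.
\<close>

lemma C_singletons_neq_Pow:
  assumes "4 \<le> card V" "m = 0 \<or> 1 + 3 * 2 ^ m < card V"
  shows "\<not> Pow V \<subseteq> C V (Suc m) (singletons V)"
proof
  assume *: "Pow V \<subseteq> C V (Suc m) (singletons V)"
  have fin: "finite V" using assms(1) by (intro card_ge_0_finite) simp
  show False
  proof (cases "m = 0")
    case True
    then show False using * C_singletons_1[OF fin, of V] assms(1) by auto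
  next
    case False
    then have large: "1 + 3 * 2 ^ m < card V" using assms(2) by blast
    \<comment> \<open>This is the first size above the small range; adding \<open>2 ^ m\<close>
      gives \<open>1 + 3 * 2 ^ m\<close>, still below \<open>card V\<close>, so \<open>J\<close> is
      not large either.\<close>
    then obtain J where "J \<subseteq> V" "card J = 2 ^ Suc m + 1"
      using obtain_subset_with_card_n[of "2 ^ Suc m + 1" V] by auto
    then show False
      using * C_singletons_small_or_large[OF fin, of J m] large by auto
  qed
qed

section \<open>The first full stage and its logarithmic form\<close>

lemma S_partition_on_eqI:
  assumes part: "partition_on X U" and card: "4 \<le> card U"
    and le: "card U \<le> 1 + 3 * 2 ^ Suc m" and gr: "m = 0 \<or> 1 + 3 * 2 ^ m < card U"
  shows "S X U (C_infty X U) = enat (Suc (Suc m))"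
proof -
  have full: "C X (Suc (Suc m)) U = Union ` Pow U"
    unfolding C_partition_on[OF part] using C_singletons_eq_Pow[of U m] card le by simp
  have "C X k U \<subseteq> Union ` Pow U" for k
    unfolding C_partition_on[OF part] by (intro image_mono C_subset_Pow) auto
  then have infty: "C_infty X U = Union ` Pow U"
    unfolding C_infty_def
  proof (intro antisym UN_least)
    show "Union ` Pow U \<subseteq> (\<Union>k\<in>{1..}. C X k U)"
      unfolding full[symmetric] by (rule UN_upper) simp
  qed
  have "C U (Suc m) (singletons U) \<subseteq> Pow U"
    by (rule C_subset_Pow) auto
  moreover obtain J where J: "J \<in> Pow U" "J \<notin> C U (Suc m) (singletons U)"
    using C_singletons_neq_Pow[OF card gr] by blast
  \<comment> \<open>Injectivity of \<open>Union\<close> rules out that another subfamily in the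
    stage has the same union as \<open>J\<close>.\<close>
  ultimately have "\<Union>J \<notin> C X (Suc m) U"
    unfolding C_partition_on[OF part]
    using inj_on_image_mem_iff[OF partition_on_Union_inj[OF part]] by metis
  then have "\<not> C_infty X U \<subseteq> C X (Suc m) U"
    unfolding infty using J(1) by (meson imageI subsetD)
  then have "Suc (Suc m) \<le> k" if "C_infty X U \<subseteq> C X k U" for k
    using that C_mono[of k "Suc m" X U] by (meson not_less_eq_eq order_trans)
  then show ?thesis
    unfolding S_def using full infty
    by (intro antisym Inf_lower Inf_greatest) auto
qed

theorem theorem5p16:
  fixes X :: "'a set" and U :: "'a set set" and n :: nat
  assumes "X \<noteq> {}"
    and "partition_on X U"
    and "card U = n"
    and "n \<ge> 4"
  shows "S X U (C_infty X U) =
    (if n \<le> 1 + 3 * 2 ^ (nat \<lfloor>log 2 (real n)\<rfloor> - 1)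
     then enat (nat \<lfloor>log 2 (real n)\<rfloor>)
     else enat (nat \<lceil>log 2 (real n)\<rceil>))"
proof -
  define L where "L = nat \<lfloor>log 2 (real n)\<rfloor>"
  have "2 \<le> log 2 (real n)"
    using assms(4) by (simp add: le_log_iff powr_realpow)
  then have "2 \<le> \<lfloor>log 2 (real n)\<rfloor>" by linarith
  then have "2 \<le> L" and floor: "\<lfloor>log 2 (real n)\<rfloor> = int L"
    unfolding L_def by linarith+
  then obtain m where m: "L = Suc (Suc m)"
    by (metis add_2_eq_Suc le_iff_add)
  have n_pos: "0 < n" using assms(4) by simp
  have lower: "2 ^ L \<le> n" and upper: "n < 2 ^ Suc L"
    using floor_log_nat_eq_powr_iff[OF order.refl n_pos, of L] floor by simp_all
  show ?thesis
  proof (cases "n \<le> 1 + 3 * 2 ^ (L - 1)")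
    case True
    \<comment> \<open>For positive \<open>m\<close> the previous threshold
      \<open>1 + 3 * 2 ^ m\<close> lies below \<open>2 ^ L = 4 * 2 ^ m\<close>. For
      \<open>m = 0\<close> both equal 4, hence the separate disjunct.\<close>
    have "m = 0 \<or> 1 + 3 * 2 ^ m < card U"
    proof (cases m)
      case (Suc k)
      have "(0::nat) < 2 ^ k" by simp
      moreover have "8 * 2 ^ k \<le> card U" using lower assms(3) m Suc by simp
      ultimately have "1 + 3 * (2 * 2 ^ k) < card U" by linarith
      then show ?thesis using Suc by simp
    qed simp
    then show ?thesis
      using S_partition_on_eqI[OF assms(2), of m] True assms(3,4) m
      by (simp add: L_def[symmetric])
  next
    case False
    \<comment> \<open>Strictness makes the ceiling \<open>L + 1\<close>. As
      \<open>n < 2 ^ Suc L\<close>, the next threshold \<open>1 + 3 * 2 ^ L\<close> is not exceeded,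
      so one further stage suffices.\<close>
    have "2 ^ L < n" using False m by simp
    then have "\<lceil>log 2 (real n)\<rceil> = int (Suc L)"
      using ceiling_log_nat_eq_powr_iff[OF order.refl n_pos, of L] upper by simp
    moreover have "S X U (C_infty X U) = enat (Suc (Suc (Suc m)))"
      using S_partition_on_eqI[OF assms(2), of "Suc m"] False upper assms(3,4) m by simp
    ultimately show ?thesis
      using False m by (simp add: L_def[symmetric])
  qed
qed

end
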